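(* For each positive integer $n$ let $\lambda_n$ denote a Young diagram with $n$ boxes, and let $I_{\lambda_n}\subseteq R_n=\mathbb{C}[x_1,\ldots,x_n]$ be its Tanisaki ideal. The only sequence of Young diagrams $\lambda_1\subseteq\lambda_2\subseteq\lambda_3\subseteq\cdots$ for which the sequence of Tanisaki ideals $\{I_{\lambda_1},I_{\lambda_2},I_{\lambda_3},\ldots\}$ forms an FI-ideal is the sequence of one-row diagrams $\lambda_n=(n)$, $n\ge 1$.
   Context: Partitions $\lambda=(\lambda_1\ge\lambda_2\ge\cdots)$ are identified with Young diagrams (left-justified rows, the longest row on top); $\lambda\subseteq\lambda'$ means containment of diagrams. Tanisaki ideal. For $S\subseteq\{x_1,\ldots,x_n\}$ let $e_i(S)=\sum_{T\subseteq S,\,|T|=i}\prod_{x_j\in T}x_j$. Let $E_{i,j}^n$ be the set of all $e_i(S)$ with $S\subseteq\{x_1,\ldots,x_n\}$, $|S|=j$. For a partition $\lambda$ of $n$, the BFR-filling of $\lambda$ is obtained as follows: going through the columns from leftmost to rightmost, place the numbers $1,2,\ldots,n-\lambda_1$ bottom to top in each column, skipping the top row; then fill the top row from right to left with $n-\lambda_1+1,\ldots,n$. The set $\mathcal{G}(\lambda)$ is the union, over all boxes of $\lambda$, of the sets $E_{i,j}^n$ where $i$ is the entry of the box and $j$ is the entry of the top-row box in the same column. The Tanisaki ideal $I_\lambda\subseteq R_n$ is the ideal generated by $\mathcal{G}(\lambda)$ (by a theorem of Biagioli–Faridi–Rosas this agrees with Tanisaki's original definition). It is homogeneous and invariant under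 permuting the variables. FI-ideals. The sequence $R=\{R_n\}_{n\ge1}$ is a graded FI-algebra: an injection $f:\{1,\ldots,m\}\to\{1,\ldots,n\}$ induces the ring homomorphism $f_*:R_m\to R_n$ with $f_*(x_i)=x_{f(i)}$. A sequence of homogeneous ideals $I_n\subseteq R_n$ forms an FI-ideal if it is a graded FI-submodule of $R$, i.e. $f_*(I_m)\subseteq I_n$ for every injection $f:\{1,\ldots,m\}\to\{1,\ldots,n\}$. *)

theory Defs
  imports Complex_Main "HOL-Library.Poly_Mapping" "HOL-Algebra.RingHom"
begin

section \<open>The polynomial rings \<open>R\<^sub>n\<close>\<close>

text \<open>
  A polynomial in the variables \<open>x\<^sub>1, x\<^sub>2, \<dots>\<close> is a finitely supported map from monomials
  (finitely supported exponent vectors) to coefficients. The ring \<open>R\<^sub>n\<close> is the subring of those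
  polynomials in which only \<open>x\<^sub>1, \<dots>, x\<^sub>n\<close> occur, packaged as a ring record so that the
  notions of ideal and of generated ideal are taken relative to \<open>R\<^sub>n\<close>.
\<close>

type_synonym cpoly = "(nat \<Rightarrow>\<^sub>0 nat) \<Rightarrow>\<^sub>0 complex"

definition var :: "nat \<Rightarrow> cpoly"
  where "var i = Poly_Mapping.single (Poly_Mapping.single i 1) 1"

definition const :: "complex \<Rightarrow> cpoly"
  where "const c = Poly_Mapping.single 0 c"

definition vars :: "cpoly \<Rightarrow> nat set"
  where "vars p = (\<Union>m\<in>Poly_Mapping.keys p. Poly_Mapping.keys m)"

definition poly_ring :: "nat \<Rightarrow> cpoly ring"
  where "poly_ring n =
    \<lparr>carrier = {p. vars p \<subseteq> {1..n}}, mult = (*), one = 1, zero = 0, add = (+)\<rparr>"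

lemma vars_simps [simp]: "vars 0 = {}" "vars 1 = {}" "vars (const c) = {}" "vars (var i) = {i}"
  by (auto simp: vars_def const_def var_def)

lemma vars_uminus: "vars (- p) = vars p"
proof -
  have "Poly_Mapping.keys (- p) = Poly_Mapping.keys p" by (auto simp: in_keys_iff)
  then show ?thesis by (simp add: vars_def)
qed

lemma vars_add: "vars (p + q) \<subseteq> vars p \<union> vars q"
  using Poly_Mapping.keys_add[of p q] by (auto simp: vars_def)

lemma vars_mult: "vars (p * q) \<subseteq> vars p \<union> vars q"
proof
  fix i assume "i \<in> vars (p * q)"
  then obtain m where "m \<in> Poly_Mapping.keys (p * q)" "i \<in> Poly_Mapping.keys m" by (auto simp: vars_def)
  moreover from this(1) obtain a b where "a \<in> Poly_Mapping.keys p" "b \<in> Poly_Mapping.keys q" "m = a + b"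
    using keys_mult[of p q] by blast
  ultimately show "i \<in> vars p \<union> vars q"
    using Poly_Mapping.keys_add[of a b] by (auto simp: vars_def)
qed

lemma poly_ring_cring: "cring (poly_ring n)"
proof (rule cringI)
  show "abelian_group (poly_ring n)"
  proof (rule abelian_groupI)
    fix p assume "p \<in> carrier (poly_ring n)"
    then show "\<exists>q\<in>carrier (poly_ring n). q \<oplus>\<^bsub>poly_ring n\<^esub> p = \<zero>\<^bsub>poly_ring n\<^esub>"
      by (intro bexI[of _ "- p"]) (auto simp: poly_ring_def vars_uminus)
  next
    fix p q assume "p \<in> carrier (poly_ring n)" "q \<in> carrier (poly_ring n)"
    then show "p \<oplus>\<^bsub>poly_ring n\<^esub> q \<in> carrier (poly_ring n)"
      using vars_add[of p q] by (auto simp: poly_ring_def)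
  qed (simp_all add: poly_ring_def algebra_simps)
  show "Group.comm_monoid (poly_ring n)"
  proof (rule comm_monoidI)
    fix p q assume "p \<in> carrier (poly_ring n)" "q \<in> carrier (poly_ring n)"
    then show "p \<otimes>\<^bsub>poly_ring n\<^esub> q \<in> carrier (poly_ring n)"
      using vars_mult[of p q] by (auto simp: poly_ring_def)
  qed (simp_all add: poly_ring_def algebra_simps)
qed (simp_all add: poly_ring_def algebra_simps)


section \<open>FI-ideals\<close>

text \<open>
  \<open>fi_map f\<close> is the substitution \<open>x\<^sub>i \<mapsto> x\<^bsub>f i\<^esub>\<close>. For \<open>f\<close> mapping \<open>{1..m}\<close> to \<open>{1..n}\<close>, its
  restriction to \<open>R\<^sub>m\<close> is the ring homomorphism \<open>f\<^sub>*\<close>; see the lemmas following the definition.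
\<close>

definition fi_map :: "(nat \<Rightarrow> nat) \<Rightarrow> cpoly \<Rightarrow> cpoly"
  where "fi_map f p =
    (\<Sum>m\<in>Poly_Mapping.keys p. const (Poly_Mapping.lookup p m) * (\<Prod>i\<in>Poly_Mapping.keys m. var (f i) ^ Poly_Mapping.lookup m i))"

lemma const_simps [simp]: "const 0 = 0" "const 1 = 1"
  "const (a + b) = const a + const b" "const (a * b) = const a * const b"
  by (simp_all add: const_def Poly_Mapping.single_add mult_single)

lemma fi_map_superset:
  assumes "finite A" "Poly_Mapping.keys p \<subseteq> A"
  shows "fi_map f p = (\<Sum>m\<in>A. const (Poly_Mapping.lookup p m) * (\<Prod>i\<in>Poly_Mapping.keys m. var (f i) ^ Poly_Mapping.lookup m i))"
  unfolding fi_map_def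
  by (rule sum.mono_neutral_left) (use assms in \<open>auto simp: in_keys_iff\<close>)

lemma fi_map_add: "fi_map f (p + q) = fi_map f p + fi_map f q"
proof -
  let ?A = "Poly_Mapping.keys p \<union> Poly_Mapping.keys q"
  have "finite ?A" by simp
  moreover have "Poly_Mapping.keys (p + q) \<subseteq> ?A" by (rule Poly_Mapping.keys_add)
  ultimately show ?thesis
    by (simp add: fi_map_superset[of ?A] lookup_add algebra_simps sum.distrib)
qed

lemma fi_map_single:
  "fi_map f (Poly_Mapping.single m c) = const c * (\<Prod>i\<in>Poly_Mapping.keys m. var (f i) ^ Poly_Mapping.lookup m i)"
  by (simp add: fi_map_def)

lemma fi_map_const [simp]: "fi_map f (const c) = const c"
  by (simp add: const_def fi_map_single)

lemma fi_map_var [simp]: "fi_map f (var i) = var (f i)"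
  by (simp add: var_def fi_map_single)

lemma prod_var_add:
  fixes a b :: "nat \<Rightarrow>\<^sub>0 nat"
  shows "(\<Prod>i\<in>Poly_Mapping.keys (a + b). var (f i) ^ Poly_Mapping.lookup (a + b) i) =
   (\<Prod>i\<in>Poly_Mapping.keys a. var (f i) ^ Poly_Mapping.lookup a i) * (\<Prod>i\<in>Poly_Mapping.keys b. var (f i) ^ Poly_Mapping.lookup b i)"
proof -
  let ?A = "Poly_Mapping.keys a \<union> Poly_Mapping.keys b"
  have *: "(\<Prod>i\<in>Poly_Mapping.keys c. var (f i) ^ Poly_Mapping.lookup c i) = (\<Prod>i\<in>?A. var (f i) ^ Poly_Mapping.lookup c i)"
    if "Poly_Mapping.keys c \<subseteq> ?A" for c :: "nat \<Rightarrow>\<^sub>0 nat"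
    by (rule prod.mono_neutral_left) (use that in \<open>auto simp: in_keys_iff\<close>)
  have "Poly_Mapping.keys (a + b) \<subseteq> ?A" by (rule Poly_Mapping.keys_add)
  then show ?thesis
    using *[of a] *[of b] *[of "a + b"] by (simp add: lookup_add power_add prod.distrib)
qed

lemma cpoly_induct [case_names zero single add]:
  assumes "P 0" "\<And>m c. P (Poly_Mapping.single m c)" "\<And>p q. P p \<Longrightarrow> P q \<Longrightarrow> P (p + q)"
  shows "P (p :: cpoly)"
proof (induction p rule: update_induct)
  case (update p m c)
  have "Poly_Mapping.update m c p = p + Poly_Mapping.single m c"
    using update.hyps
    by (intro poly_mapping_eqI) (auto simp: lookup_update lookup_add lookup_single in_keys_iff)
  then show ?case using assms update by metis
qed (use assms in auto)

lemma fi_map_0 [simp]: "fi_map f 0 = 0"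
  by (simp add: fi_map_def)

lemma fi_map_mult: "fi_map f (p * q) = fi_map f p * fi_map f q"
proof (induction p rule: cpoly_induct)
  case (single m c)
  show ?case
    by (induction q rule: cpoly_induct)
      (simp_all add: mult_single fi_map_single prod_var_add fi_map_add algebra_simps)
qed (simp_all add: fi_map_add algebra_simps)

lemma vars_fi_map: "vars (fi_map f p) \<subseteq> f ` vars p"
proof -
  have sum: "vars (sum g A) \<subseteq> B" if "\<And>a. a \<in> A \<Longrightarrow> vars (g a) \<subseteq> B"
    for g and A :: "(nat \<Rightarrow>\<^sub>0 nat) set" and B
    using that
  proof (induction A rule: infinite_finite_induct)
    case (insert a A)
    then show ?case using vars_add[of "g a" "sum g A"] by (simp add: subset_iff) blast
  qed simp_all
  have pow: "vars (p ^ k) \<subseteq> vars p" for p k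
  proof (induction k)
    case (Suc k)
    then show ?case using vars_mult[of p "p ^ k"] by (simp add: subset_iff) blast
  qed simp
  have prod: "vars (prod g A) \<subseteq> B" if "\<And>a. a \<in> A \<Longrightarrow> vars (g a) \<subseteq> B"
    for g and A :: "nat set" and B
    using that
  proof (induction A rule: infinite_finite_induct)
    case (insert a A)
    then show ?case using vars_mult[of "g a" "prod g A"] by (simp add: subset_iff) blast
  qed simp_all
  show ?thesis
    unfolding fi_map_def
  proof (rule sum)
    fix m assume m: "m \<in> Poly_Mapping.keys p"
    let ?t = "\<Prod>i\<in>Poly_Mapping.keys m. var (f i) ^ Poly_Mapping.lookup m i"
    have "vars ?t \<subseteq> f ` vars p"
    proof (rule prod)
      fix i assume "i \<in> Poly_Mapping.keys m"
      then have "i \<in> vars p" using m by (auto simp: vars_def)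
      then show "vars (var (f i) ^ Poly_Mapping.lookup m i) \<subseteq> f ` vars p"
        using pow[of "var (f i)" "Poly_Mapping.lookup m i"] by auto
    qed
    then show "vars (const (Poly_Mapping.lookup p m) * ?t) \<subseteq> f ` vars p"
      using vars_mult[of "const (Poly_Mapping.lookup p m)" ?t] by auto
  qed
qed

lemma fi_map_ring_hom:
  assumes "f ` {1..m} \<subseteq> {1..n}"
  shows "fi_map f \<in> ring_hom (poly_ring m) (poly_ring n)"
proof (rule ring_hom_memI)
  show "fi_map f p \<in> carrier (poly_ring n)" if "p \<in> carrier (poly_ring m)" for p
    using subset_trans[OF vars_fi_map[of f p] subset_trans[OF image_mono assms]] that
    by (simp add: poly_ring_def)
  show "fi_map f \<one>\<^bsub>poly_ring m\<^esub> = \<one>\<^bsub>poly_ring n\<^esub>"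
    using fi_map_const[of f 1] by (simp add: poly_ring_def)
qed (simp_all add: poly_ring_def fi_map_mult fi_map_add)

definition mon_deg :: "(nat \<Rightarrow>\<^sub>0 nat) \<Rightarrow> nat"
  where "mon_deg m = (\<Sum>i\<in>Poly_Mapping.keys m. Poly_Mapping.lookup m i)"

definition hom_component :: "nat \<Rightarrow> cpoly \<Rightarrow> cpoly"
  where "hom_component d p =
    (\<Sum>m\<in>{m\<in>Poly_Mapping.keys p. mon_deg m = d}. Poly_Mapping.single m (Poly_Mapping.lookup p m))"

definition homogeneous_ideal :: "nat \<Rightarrow> cpoly set \<Rightarrow> bool"
  where "homogeneous_ideal n I \<longleftrightarrow>
    ideal I (poly_ring n) \<and> (\<forall>p\<in>I. \<forall>d. hom_component d p \<in> I)"

text \<open>Only the members \<open>I n\<close> with \<open>n \<ge> 1\<close> matter.\<close>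

definition FI_ideal :: "(nat \<Rightarrow> cpoly set) \<Rightarrow> bool"
  where "FI_ideal I \<longleftrightarrow>
    (\<forall>n\<ge>1. homogeneous_ideal n (I n)) \<and>
    (\<forall>m\<ge>1. \<forall>n\<ge>1. \<forall>f. inj_on f {1..m} \<longrightarrow> f ` {1..m} \<subseteq> {1..n} \<longrightarrow> fi_map f ` I m \<subseteq> I n)"


section \<open>Young diagrams and the BFR-filling\<close>

text \<open>
  A partition is its weakly decreasing list of positive parts. Boxes are pairs (row, column),
  both counted from 0; row 0 is the top row and column 0 is the leftmost column.
\<close>

definition partition_of :: "nat \<Rightarrow> nat list \<Rightarrow> bool"
  where "partition_of n lam \<longleftrightarrow> sorted_wrt (\<ge>) lam \<and> 0 \<notin> set lam \<and> sum_list lam = n"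

definition young_diagram :: "nat list \<Rightarrow> (nat \<times> nat) set"
  where "young_diagram lam = {(r, c). r < length lam \<and> c < lam ! r}"

definition column_length :: "nat list \<Rightarrow> nat \<Rightarrow> nat"
  where "column_length lam c = card {r. (r, c) \<in> young_diagram lam}"

text \<open>
  The boxes of the diagram in the order in which the BFR-filling visits them; the \<open>k\<close>-th box
  visited receives the entry \<open>k\<close>, counting from 1.
\<close>

definition bfr_order :: "nat list \<Rightarrow> (nat \<times> nat) list"
  where "bfr_order lam =
    concat (map (\<lambda>c. map (\<lambda>r. (r, c)) (rev [1..<column_length lam c])) [0..<lam ! 0]) @
    map (\<lambda>c. (0, c)) (rev [0..<lam ! 0])"

definition bfr_entry :: "nat list \<Rightarrow> nat \<times> nat \<Rightarrow> nat"
  where "bfr_entry lam b = Suc (length (takeWhile (\<lambda>b'. b' \<noteq> b) (bfr_order lam)))"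

lemma column_length_code:
  "column_length lam c = length (filter (\<lambda>l. c < l) lam)"
  by (simp add: column_length_def young_diagram_def length_filter_conv_card)

text \<open>For \<open>(4, 2, 2)\<close> the rows of the filling are \<open>(8, 7, 6, 5)\<close>, \<open>(2, 4)\<close> and \<open>(1, 3)\<close>.\<close>

lemma "map (map (bfr_entry [4, 2, 2]))
    [[(0,0), (0,1), (0,2), (0,3)], [(1,0), (1,1)], [(2,0), (2,1)]] =
    [[8, 7, 6, 5], [2, 4], [1, 3]]"
  by (simp add: bfr_entry_def bfr_order_def column_length_code upt_rec)


section \<open>Tanisaki ideals\<close>

definition elem_sym :: "nat \<Rightarrow> nat set \<Rightarrow> cpoly"
  where "elem_sym i S = (\<Sum>T | T \<subseteq> S \<and> card T = i. \<Prod>j\<in>T. var j)"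

definition elem_sym_set :: "nat \<Rightarrow> nat \<Rightarrow> nat \<Rightarrow> cpoly set"
  where "elem_sym_set n i j = {elem_sym i S | S. S \<subseteq> {1..n} \<and> card S = j}"

definition tanisaki_gens :: "nat list \<Rightarrow> cpoly set"
  where "tanisaki_gens lam = (\<Union>(r, c)\<in>young_diagram lam.
    elem_sym_set (sum_list lam) (bfr_entry lam (r, c)) (bfr_entry lam (0, c)))"

definition tanisaki_ideal :: "nat list \<Rightarrow> cpoly set"
  where "tanisaki_ideal lam = Idl\<^bsub>poly_ring (sum_list lam)\<^esub> (tanisaki_gens lam)"

end

theory Submission
  imports Defs
begin

text \<open>
  Everything is decided in degree one. For a one-row diagram the box with entry \<open>1\<close> is itself in
  the top row, so the generators include every \<open>e\<^sub>1(x\<^sub>i) = x\<^sub>i\<close>, and the Tanisaki ideal is the ideal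
  of all polynomials without constant term (\<open>tanisaki_ideal_one_row\<close>). These ideals are homogeneous
  and compatible with every substitution of variables, hence form an FI-ideal.

  Conversely, the diagram with one box is a single row, so the first ideal contains \<open>x\<^sub>1\<close>, and the
  FI-property carries \<open>x\<^sub>1\<close> into every ideal of the sequence. If a diagram with \<open>n\<close> boxes has at least
  two rows, however, its box with entry \<open>1\<close> is the bottom of the first column, whose top entry is
  \<open>n\<close>. The only generator of degree one is therefore the symmetric sum \<open>x\<^sub>1 + \<dots> + x\<^sub>n\<close>, and
  all elements of the ideal have equal coefficients at \<open>x\<^sub>1, \<dots>, x\<^sub>n\<close>
  (\<open>tanisaki_ideal_lin_coeff_eq\<close>). As \<open>n \<ge> 2\<close>, this excludes \<open>x\<^sub>1\<close>.
\<close>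

section \<open>Coefficients of degree zero and one\<close>

abbreviation const_coeff :: "cpoly \<Rightarrow> complex"
  where "const_coeff p \<equiv> Poly_Mapping.lookup p 0"

abbreviation lin_coeff :: "nat \<Rightarrow> cpoly \<Rightarrow> complex"
  where "lin_coeff i p \<equiv> Poly_Mapping.lookup p (Poly_Mapping.single i 1)"

lemma monomial_add_eq_0_iff:
  fixes a b :: "nat \<Rightarrow>\<^sub>0 nat"
  shows "a + b = 0 \<longleftrightarrow> a = 0 \<and> b = 0"
  by (auto simp: poly_mapping_eq_iff fun_eq_iff lookup_add)

lemma monomial_add_eq_var_iff:
  fixes a b :: "nat \<Rightarrow>\<^sub>0 nat"
  shows "a + b = Poly_Mapping.single i 1 \<longleftrightarrow>
    a = 0 \<and> b = Poly_Mapping.single i 1 \<or> a = Poly_Mapping.single i 1 \<and> b = 0"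
    (is "?l \<longleftrightarrow> ?r")
proof
  assume ?l
  then have sum: "Poly_Mapping.lookup a j + Poly_Mapping.lookup b j = (if j = i then 1 else 0)" for j
    by (metis lookup_add lookup_single_eq lookup_single_not_eq)
  have off: "Poly_Mapping.lookup a j = 0 \<and> Poly_Mapping.lookup b j = 0" if "j \<noteq> i" for j
    using sum[of j] that by simp
  have "Poly_Mapping.lookup a i = 0 \<and> Poly_Mapping.lookup b i = 1 \<or>
      Poly_Mapping.lookup a i = 1 \<and> Poly_Mapping.lookup b i = 0"
    using sum[of i] by auto
  moreover have "c = Poly_Mapping.single i (Poly_Mapping.lookup c i)"
    if "\<And>j. j \<noteq> i \<Longrightarrow> Poly_Mapping.lookup c j = 0" for c :: "nat \<Rightarrow>\<^sub>0 nat"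
    using that by (intro poly_mapping_eqI) (auto simp: lookup_single when_def)
  from this[of a] this[of b] off
  have "a = Poly_Mapping.single i (Poly_Mapping.lookup a i)"
    "b = Poly_Mapping.single i (Poly_Mapping.lookup b i)" by auto
  ultimately show ?r by (metis single_zero)
qed auto

lemma const_coeff_mult: "const_coeff (p * q) = const_coeff p * const_coeff q"
proof (induction p rule: cpoly_induct)
  case (single m c)
  show ?case
    by (induction q rule: cpoly_induct)
      (auto simp: mult_single lookup_single lookup_add when_def monomial_add_eq_0_iff algebra_simps)
qed (simp_all add: lookup_add algebra_simps)

text \<open>
  Together with multiplicativity of the constant coefficient, this Leibniz rule says that
  \<open>p \<mapsto> (const_coeff p, lin_coeff i p)\<close> is a ring homomorphism to the dual numbers. It is what
  makes conditions on linear coefficients stable under multiplication, once the constant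
  coefficient vanishes.
\<close>

lemma lin_coeff_mult:
  "lin_coeff i (p * q) = const_coeff p * lin_coeff i q + lin_coeff i p * const_coeff q"
proof (induction p rule: cpoly_induct)
  case (single m c)
  show ?case
  proof (induction q rule: cpoly_induct)
    case (single m' c')
    have "Poly_Mapping.single i (1::nat) \<noteq> 0"
      by (metis lookup_single_eq lookup_zero one_neq_zero)
    then show ?case
      unfolding mult_single lookup_single when_def monomial_add_eq_var_iff by auto
  qed (simp_all add: lookup_add algebra_simps)
qed (simp_all add: lookup_add algebra_simps)

lemma const_coeff_var [simp]: "const_coeff (var i) = 0"
  by (metis var_def lookup_single_eq lookup_single_not_eq lookup_zero one_neq_zero)

lemma lin_coeff_var: "lin_coeff i (var j) = (if i = j then 1 else 0)"
proof -
  have "Poly_Mapping.single j (1::nat) = Poly_Mapping.single i 1 \<longleftrightarrow> i = j"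
  proof
    assume "Poly_Mapping.single j (1::nat) = Poly_Mapping.single i 1"
    then have "Poly_Mapping.lookup (Poly_Mapping.single j (1::nat)) i = 1" by simp
    then show "i = j" by (simp add: lookup_single when_def split: if_splits)
  qed simp
  then show ?thesis unfolding var_def lookup_single when_def by simp
qed

lemma const_coeff_prod_var:
  assumes "finite T" "T \<noteq> {}"
  shows "const_coeff (\<Prod>j\<in>T. var j) = 0"
proof -
  obtain a where "a \<in> T" using assms by blast
  then show ?thesis
    using assms by (simp add: prod.remove[of T a] const_coeff_mult)
qed

text \<open>
  Split off one variable: both factors have no constant term, so the Leibniz rule gives zero.
\<close>

lemma lin_coeff_prod_var:
  assumes "card T \<ge> 2"
  shows "lin_coeff i (\<Prod>j\<in>T. var j) = 0"
proof -
  have fin: "finite T" using assms card.infinite by fastforce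
  obtain a where a: "a \<in> T" using assms by fastforce
  then have "card (T - {a}) \<noteq> 0" using assms fin by simp
  then have "T - {a} \<noteq> {}" by (metis card.empty)
  then have "const_coeff (\<Prod>j\<in>T - {a}. var j) = 0"
    using fin by (intro const_coeff_prod_var) auto
  then show ?thesis
    using a fin by (simp add: prod.remove[of T a] lin_coeff_mult del: One_nat_def)
qed

lemma const_coeff_elem_sym:
  assumes "k \<ge> 1"
  shows "const_coeff (elem_sym k S) = 0"
  unfolding elem_sym_def lookup_sum
proof (intro sum.neutral ballI)
  fix T assume "T \<in> {T. T \<subseteq> S \<and> card T = k}"
  with assms show "const_coeff (\<Prod>j\<in>T. var j) = 0"
    by (intro const_coeff_prod_var) (auto intro: card_ge_0_finite)
qed

lemma lin_coeff_elem_sym: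
  assumes "k \<ge> 2"
  shows "lin_coeff i (elem_sym k S) = 0"
  unfolding elem_sym_def lookup_sum
  using assms by (intro sum.neutral ballI lin_coeff_prod_var) auto

lemma elem_sym_1: "elem_sym 1 S = (\<Sum>j\<in>S. var j)"
proof -
  have "{T. T \<subseteq> S \<and> card T = 1} = (\<lambda>j. {j}) ` S"
    by (auto simp: card_1_singleton_iff)
  then show ?thesis
    by (simp add: elem_sym_def sum.reindex)
qed

lemma lin_coeff_elem_sym_1:
  assumes "finite S" "i \<in> S"
  shows "lin_coeff i (elem_sym 1 S) = 1"
  using assms unfolding elem_sym_1 lookup_sum lin_coeff_var by simp

section \<open>Two ideals cut out by low-degree coefficients\<close>

lemma idealI_poly_ring:
  assumes "I \<subseteq> carrier (poly_ring n)" "0 \<in> I"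
    and "\<And>p q. p \<in> I \<Longrightarrow> q \<in> I \<Longrightarrow> p + q \<in> I"
    and mult: "\<And>p q. p \<in> I \<Longrightarrow> q \<in> carrier (poly_ring n) \<Longrightarrow> q * p \<in> I"
  shows "ideal I (poly_ring n)"
proof -
  interpret cring "poly_ring n" by (rule poly_ring_cring)
  have ops: "\<zero>\<^bsub>poly_ring n\<^esub> = 0" "add (poly_ring n) = (+)" "mult (poly_ring n) = (*)"
    by (simp_all add: poly_ring_def)
  have "\<ominus>\<^bsub>poly_ring n\<^esub> p \<in> I" if "p \<in> I" for p
  proof -
    have p: "p \<in> carrier (poly_ring n)" using assms(1) that by blast
    have "\<ominus>\<^bsub>poly_ring n\<^esub> p = (\<ominus>\<^bsub>poly_ring n\<^esub> \<one>\<^bsub>poly_ring n\<^esub>) \<otimes>\<^bsub>poly_ring n\<^esub> p"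
      using p by (simp add: l_minus)
    then show ?thesis using mult[OF that] by (simp add: ops)
  qed
  then have "subgroup I (add_monoid (poly_ring n))"
    using assms by (intro add.subgroupI) (auto simp: ops)
  then show ?thesis
    using assms(1) mult
    by (intro idealI ring_axioms) (auto simp: ops mult.commute)
qed

lemma ideal_const_coeff_0: "ideal {p \<in> carrier (poly_ring n). const_coeff p = 0} (poly_ring n)"
proof -
  interpret cring "poly_ring n" by (rule poly_ring_cring)
  show ?thesis
    using zero_closed a_closed m_closed
    by (intro idealI_poly_ring) (auto simp: poly_ring_def lookup_add const_coeff_mult)
qed

text \<open>
  Multiplying \<open>p\<close> without constant term by \<open>q\<close> scales all its linear coefficients by the same
  number, the constant coefficient of \<open>q\<close>; an equality between two of them persists. This ideal
  separates \<open>x\<^sub>i\<close> from the Tanisaki ideals of diagrams with several rows.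
\<close>

lemma ideal_lin_coeff_eq:
  "ideal {p \<in> carrier (poly_ring n). const_coeff p = 0 \<and> lin_coeff i p = lin_coeff j p} (poly_ring n)"
proof -
  interpret cring "poly_ring n" by (rule poly_ring_cring)
  show ?thesis
    using zero_closed a_closed m_closed
    by (intro idealI_poly_ring)
      (auto simp: poly_ring_def lookup_add const_coeff_mult lin_coeff_mult simp del: One_nat_def)
qed

section \<open>The generators of a Tanisaki ideal\<close>

lemma vars_elem_sym: "vars (elem_sym k S) \<subseteq> S"
proof -
  have prod: "vars (\<Prod>j\<in>T. var j) \<subseteq> T" for T
  proof (induction T rule: infinite_finite_induct)
    case (insert a T)
    then show ?case using vars_mult[of "var a" "\<Prod>j\<in>T. var j"] by auto
  qed simp_all
  have sum: "vars (\<Sum>T\<in>F. \<Prod>j\<in>T. var j) \<subseteq> S" if "\<And>T. T \<in> F \<Longrightarrow> T \<subseteq> S" for F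
    using that
  proof (induction F rule: infinite_finite_induct)
    case (insert T F)
    have "vars (\<Prod>j\<in>T. var j) \<subseteq> S" "vars (\<Sum>T\<in>F. \<Prod>j\<in>T. var j) \<subseteq> S"
      using prod[of T] insert by auto
    then show ?case
      using insert(1,2) vars_add[of "\<Prod>j\<in>T. var j" "\<Sum>T\<in>F. \<Prod>j\<in>T. var j"] by auto
  qed simp_all
  show ?thesis unfolding elem_sym_def by (rule sum) simp
qed

lemma tanisaki_gens_closed: "tanisaki_gens lam \<subseteq> carrier (poly_ring (sum_list lam))"
proof
  fix p assume "p \<in> tanisaki_gens lam"
  then obtain k S where "p = elem_sym k S" "S \<subseteq> {1..sum_list lam}"
    unfolding tanisaki_gens_def elem_sym_set_def by blast
  then show "p \<in> carrier (poly_ring (sum_list lam))"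
    using vars_elem_sym[of k S] by (auto simp: poly_ring_def)
qed

lemma tanisaki_ideal_subset:
  assumes "ideal I (poly_ring (sum_list lam))" "tanisaki_gens lam \<subseteq> I"
  shows "tanisaki_ideal lam \<subseteq> I"
proof -
  interpret cring "poly_ring (sum_list lam)" by (rule poly_ring_cring)
  show ?thesis
    unfolding tanisaki_ideal_def using assms by (rule genideal_minimal)
qed

lemma ideal_tanisaki_ideal: "ideal (tanisaki_ideal lam) (poly_ring (sum_list lam))"
proof -
  interpret cring "poly_ring (sum_list lam)" by (rule poly_ring_cring)
  show ?thesis
    unfolding tanisaki_ideal_def by (rule genideal_ideal[OF tanisaki_gens_closed])
qed

lemma tanisaki_gens_subset_ideal: "tanisaki_gens lam \<subseteq> tanisaki_ideal lam"
proof -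
  interpret cring "poly_ring (sum_list lam)" by (rule poly_ring_cring)
  show ?thesis
    unfolding tanisaki_ideal_def by (rule genideal_self[OF tanisaki_gens_closed])
qed

lemma tanisaki_ideal_const_coeff:
  assumes "p \<in> tanisaki_ideal lam"
  shows "p \<in> carrier (poly_ring (sum_list lam))" "const_coeff p = 0"
proof -
  have "tanisaki_gens lam \<subseteq> {p \<in> carrier (poly_ring (sum_list lam)). const_coeff p = 0}"
  proof
    fix p assume p: "p \<in> tanisaki_gens lam"
    then obtain b S where "p = elem_sym (bfr_entry lam b) S"
      unfolding tanisaki_gens_def elem_sym_set_def by blast
    then have "const_coeff p = 0"
      by (simp add: const_coeff_elem_sym bfr_entry_def)
    then show "p \<in> {p \<in> carrier (poly_ring (sum_list lam)). const_coeff p = 0}"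
      using p tanisaki_gens_closed by blast
  qed
  from tanisaki_ideal_subset[OF ideal_const_coeff_0 this] assms
  show "p \<in> carrier (poly_ring (sum_list lam))" "const_coeff p = 0" by auto
qed

section \<open>The ideal of a one-row diagram\<close>

lemma bfr_order_one_row: "bfr_order [n] = map (\<lambda>c. (0, c)) (rev [0..<n])"
  by (simp add: bfr_order_def column_length_code)

text \<open>
  The filling numbers the boxes in the order of the visit, so identifying the box with entry
  \<open>1\<close>, the only source of linear generators, amounts to finding the first box visited.
\<close>

lemma bfr_entry_hd:
  assumes "bfr_order lam \<noteq> []"
  shows "bfr_entry lam b = 1 \<longleftrightarrow> b = hd (bfr_order lam)"
  using assms by (cases "bfr_order lam") (auto simp: bfr_entry_def)

lemma var_in_tanisaki_ideal_one_row:
  assumes "i \<in> {1..n}"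
  shows "var i \<in> tanisaki_ideal [n]"
proof -
  have n: "n \<ge> 1" using assms by simp
  then have "bfr_order [n] \<noteq> []" "hd (bfr_order [n]) = (0, n - 1)"
    by (cases n; simp add: bfr_order_one_row)+
  then have "bfr_entry [n] (0, n - 1) = 1"
    using bfr_entry_hd by metis
  moreover have "(0, n - 1) \<in> young_diagram [n]"
    using n by (simp add: young_diagram_def)
  moreover have "var i \<in> elem_sym_set n 1 1"
    unfolding elem_sym_set_def using assms
    by (auto intro!: exI[of _ "{i}"] simp: elem_sym_1[simplified])
  ultimately have "var i \<in> tanisaki_gens [n]"
    unfolding tanisaki_gens_def by force
  then show ?thesis using tanisaki_gens_subset_ideal by blast
qed

text \<open>
  The ideal contains every variable, and a polynomial without constant term is a sum of monomials
  each of which is divisible by some variable.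
\<close>

lemma tanisaki_ideal_one_row:
  "tanisaki_ideal [n] = {p \<in> carrier (poly_ring n). const_coeff p = 0}"
proof (intro equalityI subsetI)
  show "p \<in> {p \<in> carrier (poly_ring n). const_coeff p = 0}" if "p \<in> tanisaki_ideal [n]" for p
    using tanisaki_ideal_const_coeff[OF that] by simp
next
  interpret ideal "tanisaki_ideal [n]" "poly_ring n"
    using ideal_tanisaki_ideal[of "[n]"] by simp
  have zero: "0 \<in> tanisaki_ideal [n]"
    using additive_subgroup.zero_closed[OF is_additive_subgroup] by (simp add: poly_ring_def)
  have add: "p + q \<in> tanisaki_ideal [n]"
    if "p \<in> tanisaki_ideal [n]" "q \<in> tanisaki_ideal [n]" for p q
    using additive_subgroup.a_closed[OF is_additive_subgroup that] by (simp add: poly_ring_def)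
  have term_in: "Poly_Mapping.single m c \<in> tanisaki_ideal [n]"
    if m: "m \<noteq> 0" "Poly_Mapping.keys m \<subseteq> {1..n}" for m c
  proof -
    obtain i where i: "i \<in> Poly_Mapping.keys m" using m(1) by fastforce
    \<comment> \<open>The cofactor of \<open>x\<^sub>i\<close> in the monomial \<open>m\<close>.\<close>
    let ?u = "m - Poly_Mapping.single i 1"
    have "?u + Poly_Mapping.single i 1 = m"
      using i by (intro poly_mapping_eqI)
        (auto simp: lookup_add lookup_minus lookup_single when_def in_keys_iff)
    then have "Poly_Mapping.single ?u c * var i = Poly_Mapping.single m c"
      by (simp add: var_def mult_single)
    moreover have "Poly_Mapping.keys ?u \<subseteq> {1..n}"
      using m(2) by (auto simp: lookup_minus in_keys_iff subset_iff)
    then have "Poly_Mapping.single ?u c \<in> carrier (poly_ring n)"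
      by (simp add: poly_ring_def vars_def)
    ultimately show ?thesis
      using I_l_closed[OF var_in_tanisaki_ideal_one_row[of i n]] i m(2)
      by (force simp: poly_ring_def)
  qed
  fix p assume p: "p \<in> {p \<in> carrier (poly_ring n). const_coeff p = 0}"
  have "(\<Sum>m\<in>F. Poly_Mapping.single m (Poly_Mapping.lookup p m)) \<in> tanisaki_ideal [n]"
    if "finite F" "F \<subseteq> Poly_Mapping.keys p" for F
    using that
  proof (induction F)
    case (insert m F)
    have "m \<noteq> 0" "Poly_Mapping.keys m \<subseteq> {1..n}"
      using insert.prems p by (auto simp: poly_ring_def vars_def)
    then show ?case using insert term_in add by simp
  qed (simp add: zero)
  moreover have "(\<Sum>m\<in>Poly_Mapping.keys p. Poly_Mapping.single m (Poly_Mapping.lookup p m)) = p"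
    by (intro poly_mapping_eqI) (simp add: lookup_sum lookup_single when_def in_keys_iff)
  ultimately show "p \<in> tanisaki_ideal [n]"
    by (metis finite_keys subset_refl)
qed

text \<open>
  Substituting variables for variables fixes constants and sends a nontrivial monomial to a
  nontrivial monomial. Thus the ideals of one-row diagrams, being described by the constant
  coefficient alone, are carried into each other.
\<close>

lemma const_coeff_fi_map: "const_coeff (fi_map f p) = const_coeff p"
proof (induction p rule: cpoly_induct)
  case (single m c)
  have pow: "const_coeff (var j ^ k) = 0" if "k \<noteq> 0" for j k
    using that by (cases k) (simp_all add: const_coeff_mult)
  show ?case
  proof (cases "m = 0")
    case False
    then obtain i where i: "i \<in> Poly_Mapping.keys m" by fastforce
    then have "const_coeff (\<Prod>i\<in>Poly_Mapping.keys m. var (f i) ^ Poly_Mapping.lookup m i) = 0"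
      by (simp add: prod.remove[OF _ i] const_coeff_mult pow in_keys_iff)
    with False show ?thesis
      by (simp add: fi_map_single const_coeff_mult lookup_single)
  qed (simp add: fi_map_single const_def)
qed (simp_all add: fi_map_add lookup_add)

lemma vars_hom_component: "vars (hom_component d p) \<subseteq> vars p"
proof -
  have "Poly_Mapping.keys (hom_component d p) \<subseteq> Poly_Mapping.keys p"
    by (force simp: hom_component_def in_keys_iff lookup_sum lookup_single when_def
        intro: ccontr)
  then show ?thesis by (auto simp: vars_def)
qed

lemma const_coeff_hom_component:
  assumes "const_coeff p = 0"
  shows "const_coeff (hom_component d p) = 0"
  unfolding hom_component_def lookup_sum
  using assms by (intro sum.neutral) (auto simp: lookup_single when_def)

lemma FI_ideal_one_row:
  assumes "\<And>n. n \<ge> 1 \<Longrightarrow> lam n = [n]"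
  shows "FI_ideal (\<lambda>n. tanisaki_ideal (lam n))"
  unfolding FI_ideal_def
proof (intro conjI allI impI)
  fix n :: nat assume n: "n \<ge> 1"
  have "ideal (tanisaki_ideal [n]) (poly_ring n)"
    using ideal_tanisaki_ideal[of "[n]"] by simp
  moreover have "hom_component d p \<in> tanisaki_ideal [n]" if "p \<in> tanisaki_ideal [n]" for p d
    using that vars_hom_component[of d p] const_coeff_hom_component[of p d]
    by (auto simp: tanisaki_ideal_one_row poly_ring_def)
  ultimately show "homogeneous_ideal n (tanisaki_ideal (lam n))"
    by (simp add: assms[OF n] homogeneous_ideal_def)
next
  fix m n :: nat and f
  assume mn: "m \<ge> 1" "n \<ge> 1" and f: "f ` {1..m} \<subseteq> {1..n}"
  show "fi_map f ` tanisaki_ideal (lam m) \<subseteq> tanisaki_ideal (lam n)"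
    using ring_hom_closed[OF fi_map_ring_hom[OF f]]
    by (auto simp: assms[OF mn(1)] assms[OF mn(2)] tanisaki_ideal_one_row const_coeff_fi_map)
qed

section \<open>Diagrams with several rows\<close>

lemma sum_column_lengths:
  assumes "\<forall>l\<in>set lam. l \<le> M"
  shows "(\<Sum>c<M. column_length lam c) = sum_list lam"
  using assms
proof (induction lam)
  case (Cons l lam)
  have "(\<Sum>c<M. if c < l then 1 else 0) = l"
  proof -
    have "{..<M} \<inter> {c. c < l} = {..<l}" using Cons.prems by auto
    then show ?thesis by (simp add: sum.If_cases)
  qed
  moreover have "column_length (l # lam) c = (if c < l then 1 else 0) + column_length lam c" for c
    by (simp add: column_length_code)
  ultimately show ?case
    using Cons by (simp add: sum.distrib)
qed (simp add: column_length_code)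

text \<open>
  The corner box is the last one visited, so its entry is the number of boxes. The count goes
  column by column: each column contributes its boxes below the top row, and the top row adds
  one box per column.
\<close>

lemma bfr_entry_corner:
  assumes "partition_of n lam" "lam \<noteq> []"
  shows "bfr_entry lam (0, 0) = n"
proof -
  let ?M = "lam ! 0"
  define A where "A = concat (map (\<lambda>c. map (\<lambda>r. (r, c)) (rev [1..<column_length lam c])) [0..<?M])"
  define B where "B = map (\<lambda>c. (0::nat, c)) (rev [1..<?M])"
  have le: "\<forall>l\<in>set lam. l \<le> ?M" and M: "?M > 0"
    using assms by (cases lam; auto simp: partition_of_def)+
  then have order: "bfr_order lam = (A @ B) @ [(0, 0)]"
    by (simp add: bfr_order_def A_def B_def upt_rec[of 0])
  have "(0, 0) \<notin> set (A @ B)"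
    by (auto simp: A_def B_def)
  then have "takeWhile (\<lambda>b'. b' \<noteq> (0, 0)) (bfr_order lam) = A @ B"
    unfolding order by (subst takeWhile_append2) auto
  then have "bfr_entry lam (0, 0) = length A + ?M"
    using M by (simp add: bfr_entry_def B_def)
  also have "length A = (\<Sum>c<?M. column_length lam c - 1)"
    by (simp add: A_def length_concat o_def interv_sum_list_conv_sum_set_nat atLeast0LessThan)
  also have "\<dots> + ?M = (\<Sum>c<?M. (column_length lam c - 1) + 1)"
    unfolding sum.distrib by simp
  also have "\<dots> = (\<Sum>c<?M. column_length lam c)"
    using assms(2) by (intro sum.cong) (auto simp: column_length_code neq_Nil_conv)
  also have "\<dots> = n"
    using sum_column_lengths[OF le] assms(1) by (simp add: partition_of_def)
  finally show ?thesis .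
qed

text \<open>
  With at least two rows the first column reaches below the top row, so the visit starts at its
  bottom box.
\<close>

lemma hd_bfr_order:
  assumes "partition_of n lam" "length lam \<ge> 2"
  shows "bfr_order lam \<noteq> []" "snd (hd (bfr_order lam)) = 0"
proof -
  have "column_length lam 0 = length lam"
  proof -
    have "filter (\<lambda>l. 0 < l) lam = lam"
      using assms(1) by (auto simp: partition_of_def intro!: filter_True intro: gr0I)
    then show ?thesis by (simp add: column_length_code)
  qed
  moreover have "lam ! 0 > 0"
    using assms by (cases lam; auto simp: partition_of_def)
  moreover obtain k where "length lam = Suc (Suc k)"
    using assms(2) that[of "length lam - 2"] by simp
  ultimately have "\<exists>xs. bfr_order lam = (Suc k, 0) # xs"
    by (simp add: bfr_order_def upt_rec[of 0 "lam ! 0"])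
  then show "bfr_order lam \<noteq> []" "snd (hd (bfr_order lam)) = 0" by auto
qed

text \<open>
  It suffices to inspect the generators. Those of degree at least two have no linear part. A
  generator of degree one comes from the box with entry \<open>1\<close>; this box lies in the first column,
  whose top entry is \<open>n\<close>, which forces the generator to be \<open>x\<^sub>1 + \<dots> + x\<^sub>n\<close>.
\<close>

lemma tanisaki_ideal_lin_coeff_eq:
  assumes "partition_of n lam" "length lam \<ge> 2" "p \<in> tanisaki_ideal lam"
    and ij: "i \<in> {1..n}" "j \<in> {1..n}"
  shows "lin_coeff i p = lin_coeff j p"
proof -
  have n: "sum_list lam = n" using assms(1) by (simp add: partition_of_def)
  let ?J = "{p \<in> carrier (poly_ring n). const_coeff p = 0 \<and> lin_coeff i p = lin_coeff j p}"
  have "tanisaki_gens lam \<subseteq> ?J"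
  proof
    fix p assume p: "p \<in> tanisaki_gens lam"
    then have p': "p \<in> carrier (poly_ring n)" "const_coeff p = 0"
      using tanisaki_gens_subset_ideal tanisaki_ideal_const_coeff[of p lam] n by auto
    obtain r c S where S: "p = elem_sym (bfr_entry lam (r, c)) S" "S \<subseteq> {1..n}"
        "card S = bfr_entry lam (0, c)"
      using p n unfolding tanisaki_gens_def elem_sym_set_def by blast
    have "lin_coeff i p = lin_coeff j p"
    proof (cases "bfr_entry lam (r, c) = 1")
      case True
      then have "c = 0"
        using bfr_entry_hd hd_bfr_order[OF assms(1,2)] by (metis snd_conv)
      then have "card S = n"
        using S(3) bfr_entry_corner assms(1,2) by force
      then have "S = {1..n}"
        using S(2) by (intro card_subset_eq) auto
      then show ?thesis
        using ij True by (simp only: S(1) lin_coeff_elem_sym_1 finite_atLeastAtMost)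
    next
      case False
      moreover have "bfr_entry lam (r, c) \<ge> 1" by (simp add: bfr_entry_def)
      ultimately have "bfr_entry lam (r, c) \<ge> 2" by linarith
      then show ?thesis by (simp only: S(1) lin_coeff_elem_sym)
    qed
    with p' show "p \<in> ?J" by simp
  qed
  with tanisaki_ideal_subset[of ?J lam] ideal_lin_coeff_eq[of n i j] assms(3) n
  show ?thesis by auto
qed

lemma var_notin_tanisaki_ideal:
  assumes "partition_of n lam" "length lam \<ge> 2"
  shows "var 1 \<notin> tanisaki_ideal lam"
proof
  assume "var 1 \<in> tanisaki_ideal lam"
  moreover have "n \<ge> 2"
  proof -
    obtain a b xs where "lam = a # b # xs"
      using assms(2) by (metis Suc_le_length_iff numeral_2_eq_2)
    then show ?thesis using assms(1) by (auto simp: partition_of_def)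
  qed
  ultimately have "lin_coeff 1 (var 1) = lin_coeff 2 (var 1)"
    using assms by (intro tanisaki_ideal_lin_coeff_eq) auto
  then show False unfolding lin_coeff_var by simp
qed

theorem theorem2:
  fixes lam :: "nat \<Rightarrow> nat list"
  shows "((\<forall>n\<ge>1. partition_of n (lam n)) \<and>
          (\<forall>n\<ge>1. young_diagram (lam n) \<subseteq> young_diagram (lam (Suc n))) \<and>
          FI_ideal (\<lambda>n. tanisaki_ideal (lam n)))
     \<longleftrightarrow> (\<forall>n\<ge>1. lam n = [n])"
proof (intro iffI)
  assume L: "(\<forall>n\<ge>1. partition_of n (lam n)) \<and>
          (\<forall>n\<ge>1. young_diagram (lam n) \<subseteq> young_diagram (lam (Suc n))) \<and>
          FI_ideal (\<lambda>n. tanisaki_ideal (lam n))"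
  have one_row: "lam n = [n]" if "n \<ge> 1" "length (lam n) < 2" for n
    using L that by (cases "lam n") (auto simp: partition_of_def)
  have "length (lam 1) < 2"
  proof (rule ccontr)
    assume "\<not> length (lam 1) < 2"
    then obtain a b xs where "lam 1 = a # b # xs"
      by (metis Suc_le_length_iff numeral_2_eq_2 not_less)
    moreover have "partition_of 1 (lam 1)" using L by simp
    ultimately show False by (auto simp: partition_of_def)
  qed
  then have "lam 1 = [1]" by (intro one_row) simp_all
  then have "var 1 \<in> tanisaki_ideal (lam 1)"
    using var_in_tanisaki_ideal_one_row[of 1 1] by simp
  show "\<forall>n\<ge>1. lam n = [n]"
  proof (intro allI impI)
    fix n :: nat assume n: "n \<ge> 1"
    then have "inj_on id {1..1::nat}" "id ` {1..1} \<subseteq> {1..n}" by auto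
    then have "fi_map id ` tanisaki_ideal (lam 1) \<subseteq> tanisaki_ideal (lam n)"
      using L n unfolding FI_ideal_def by blast
    then have "fi_map id (var 1) \<in> tanisaki_ideal (lam n)"
      using \<open>var 1 \<in> tanisaki_ideal (lam 1)\<close> by blast
    then have "\<not> length (lam n) \<ge> 2"
      using var_notin_tanisaki_ideal[of n "lam n"] L n by auto
    then show "lam n = [n]" using one_row n by simp
  qed
next
  assume R: "\<forall>n\<ge>1. lam n = [n]"
  then show "(\<forall>n\<ge>1. partition_of n (lam n)) \<and>
          (\<forall>n\<ge>1. young_diagram (lam n) \<subseteq> young_diagram (lam (Suc n))) \<and>
          FI_ideal (\<lambda>n. tanisaki_ideal (lam n))"
    using FI_ideal_one_row[of lam] by (auto simp: partition_of_def young_diagram_def)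
qed

end
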